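(* Let $Y$ be a real topological vector space, $F,D\subseteq Y$ and $\varphi:F\to\mathbb{R}$. (a) $\operatorname{WEff}(F,D)\cap\operatorname{argmin}_F\varphi\subseteq\operatorname{WEff}(\operatorname{argmin}_F\varphi,D)$. (b) If $\varphi$ is $(\operatorname{int}D)$-monotone on $F$, then $\operatorname{WEff}(F,D)\cap\operatorname{argmin}_F\varphi=\operatorname{WEff}(\operatorname{argmin}_F\varphi,D)$. If, additionally, $\operatorname{argmin}_F\varphi=\{y^0\}$, then $y^0\in\operatorname{WEff}(F,D)$. (c) If $\varphi$ is strictly $(\operatorname{int}D)$-monotone on $F$, then $\operatorname{argmin}_F\varphi\subseteq\operatorname{WEff}(F,D)$.
   Context: $\operatorname{Eff}(F,D):=\{y^0\in F\mid F\cap(y^0-D)\subseteq\{y^0\}\}$ and $\operatorname{WEff}(F,D):=\operatorname{Eff}(F,\operatorname{int}D)$. $\operatorname{argmin}_F\varphi$ is the set of minimizers of $\varphi$ on $F$ (empty if no minimum is attained). For $B\subseteq Y$, $\varphi$ is $B$-monotone on $F$ if $y^1,y^2\in F$ and $y^2-y^1\in B$ imply $\varphi(y^1)\le\varphi(y^2)$; it is strictly $B$-monotone on $F$ if $y^1,y^2\in F$ and $y^2-y^1\in B\setminus\{0\}$ imply $\varphi(y^1)<\varphi(y^2)$. *)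

theory Defs
  imports "HOL-Analysis.Analysis"
begin

text \<open>No separation axiom is part of the definition. The class axiom is continuity of scalar
  multiplication at every point of the product, stated through neighbourhood filters because the
  product topology on pairs is not available inside the class specification.\<close>

class real_topological_vector_space = real_vector + topological_ab_group_add +
  assumes tendsto_scaleR_Pair:
    "LIM x (nhds c \<times>\<^sub>F nhds a). fst x *\<^sub>R snd x :> nhds (c *\<^sub>R a)"

lemma continuous_on_scaleR_Pair:
  "continuous_on UNIV (\<lambda>(c, x::'a::real_topological_vector_space). c *\<^sub>R x)"
  using tendsto_scaleR_Pair
  by (auto simp: continuous_on_def case_prod_unfold nhds_prod intro!: tendsto_mono[OF at_within_le_nhds])

instance real_normed_vector \<subseteq> real_topological_vector_space
proof
  fix c :: real and a :: 'a
  show "LIM x (nhds c \<times>\<^sub>F nhds a). fst x *\<^sub>R snd x :> nhds (c *\<^sub>R a)"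
    by (intro tendsto_scaleR filterlim_fst filterlim_snd)
qed

definition Eff :: "'a::real_vector set \<Rightarrow> 'a set \<Rightarrow> 'a set" where
  "Eff F D = {y0 \<in> F. F \<inter> (\<lambda>d. y0 - d) ` D \<subseteq> {y0}}"

definition WEff :: "'a::real_topological_vector_space set \<Rightarrow> 'a set \<Rightarrow> 'a set" where
  "WEff F D = Eff F (interior D)"

text \<open>A function from \<open>F\<close> to the reals is represented by a total function; the notions
  below only depend on its values on \<open>F\<close>.\<close>

definition argmin :: "'a set \<Rightarrow> ('a \<Rightarrow> real) \<Rightarrow> 'a set" where
  "argmin F \<phi> = {y. is_arg_min \<phi> (\<lambda>z. z \<in> F) y}"

definition B_monotone_on :: "'a::real_vector set \<Rightarrow> 'a set \<Rightarrow> ('a \<Rightarrow> real) \<Rightarrow> bool" where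
  "B_monotone_on B F \<phi> \<longleftrightarrow> (\<forall>y1\<in>F. \<forall>y2\<in>F. y2 - y1 \<in> B \<longrightarrow> \<phi> y1 \<le> \<phi> y2)"

definition strictly_B_monotone_on :: "'a::real_vector set \<Rightarrow> 'a set \<Rightarrow> ('a \<Rightarrow> real) \<Rightarrow> bool" where
  "strictly_B_monotone_on B F \<phi> \<longleftrightarrow> (\<forall>y1\<in>F. \<forall>y2\<in>F. y2 - y1 \<in> B - {0} \<longrightarrow> \<phi> y1 < \<phi> y2)"

end

theory Submission
  imports Defs
begin

text \<open>
  Suppose \<open>y\<^sub>0\<close> minimizes \<open>\<phi>\<close> on \<open>F\<close>, and some \<open>y \<in> F\<close> dominates it, that is,
  \<open>y\<^sub>0 - y \<in> B\<close>. If \<open>\<phi>\<close> is \<open>B\<close>-monotone, then \<open>\<phi> y \<le> \<phi> y\<^sub>0\<close>, so \<open>y\<close> is a minimizer too: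
  the set of minimizers contains every point of \<open>F\<close> that dominates one of its elements, and
  efficiency of a minimizer is decided inside that set (\<open>Eff_argmin_eq\<close>). A unique minimizer has
  only itself as a competitor there. If \<open>\<phi>\<close> is strictly monotone, then a dominating \<open>y \<noteq> y\<^sub>0\<close> would
  have a value below the minimum, so there is none (\<open>argmin_subset_Eff\<close>). Conversely,
  passing to a smaller set of competitors never destroys efficiency (\<open>Eff_antimono\<close>).

  The domination set \<open>B\<close> is arbitrary here; weak efficiency is the case \<open>B = interior D\<close>.
\<close>

lemma mem_Eff_iff: "y0 \<in> Eff F B \<longleftrightarrow> y0 \<in> F \<and> (\<forall>y\<in>F. y0 - y \<in> B \<longrightarrow> y = y0)"
proof -
  have "y \<in> (\<lambda>d. y0 - d) ` B \<longleftrightarrow> y0 - y \<in> B" for y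
    by (force simp: image_iff)
  then show ?thesis
    unfolding Eff_def by blast
qed

lemma mem_argmin_iff: "y \<in> argmin F \<phi> \<longleftrightarrow> y \<in> F \<and> (\<forall>z\<in>F. \<phi> y \<le> \<phi> z)"
  by (auto simp: argmin_def is_arg_min_linorder)

lemma argmin_subset: "argmin F \<phi> \<subseteq> F"
  by (auto simp: mem_argmin_iff)

lemma Eff_antimono: "G \<subseteq> F \<Longrightarrow> Eff F B \<inter> G \<subseteq> Eff G B"
  unfolding subset_iff Int_iff mem_Eff_iff by blast

lemma Eff_singleton: "Eff {y0} B = {y0}"
  by (auto simp: mem_Eff_iff)

lemma dominating_point_in_argmin:
  assumes "B_monotone_on B F \<phi>" "y0 \<in> argmin F \<phi>" "y \<in> F" "y0 - y \<in> B"
  shows "y \<in> argmin F \<phi>"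
proof -
  have "y0 \<in> F" "\<forall>z\<in>F. \<phi> y0 \<le> \<phi> z"
    using assms(2) by (auto simp: mem_argmin_iff)
  moreover from this have "\<phi> y \<le> \<phi> y0"
    using assms(1,3,4) by (auto simp: B_monotone_on_def)
  ultimately show ?thesis
    using assms(3) by (force simp: mem_argmin_iff)
qed

lemma Eff_argmin_eq:
  assumes "B_monotone_on B F \<phi>"
  shows "Eff F B \<inter> argmin F \<phi> = Eff (argmin F \<phi>) B"
proof
  show "Eff F B \<inter> argmin F \<phi> \<subseteq> Eff (argmin F \<phi>) B"
    by (rule Eff_antimono[OF argmin_subset])
  show "Eff (argmin F \<phi>) B \<subseteq> Eff F B \<inter> argmin F \<phi>"
    using argmin_subset[of F \<phi>] dominating_point_in_argmin[OF assms]
    unfolding subset_iff Int_iff mem_Eff_iff by blast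
qed

lemma argmin_subset_Eff:
  assumes "strictly_B_monotone_on B F \<phi>"
  shows "argmin F \<phi> \<subseteq> Eff F B"
proof
  fix y0 assume "y0 \<in> argmin F \<phi>"
  then have y0: "y0 \<in> F" and min: "\<And>z. z \<in> F \<Longrightarrow> \<phi> y0 \<le> \<phi> z"
    by (auto simp: mem_argmin_iff)
  have "y = y0" if "y \<in> F" "y0 - y \<in> B" for y
  proof (rule ccontr)
    assume "y \<noteq> y0"
    with that y0 assms have "\<phi> y < \<phi> y0"
      by (auto simp: strictly_B_monotone_on_def)
    with min[OF \<open>y \<in> F\<close>] show False
      by simp
  qed
  with y0 show "y0 \<in> Eff F B"
    by (simp add: mem_Eff_iff)
qed

theorem proposition7:
  fixes F D :: "'a::real_topological_vector_space set"
    and \<phi> :: "'a \<Rightarrow> real"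
  shows "WEff F D \<inter> argmin F \<phi> \<subseteq> WEff (argmin F \<phi>) D
    \<and> (B_monotone_on (interior D) F \<phi> \<longrightarrow>
          WEff F D \<inter> argmin F \<phi> = WEff (argmin F \<phi>) D
        \<and> (\<forall>y0. argmin F \<phi> = {y0} \<longrightarrow> y0 \<in> WEff F D))
    \<and> (strictly_B_monotone_on (interior D) F \<phi> \<longrightarrow> argmin F \<phi> \<subseteq> WEff F D)"
  unfolding WEff_def
proof (intro conjI impI allI)
  show "Eff F (interior D) \<inter> argmin F \<phi> \<subseteq> Eff (argmin F \<phi>) (interior D)"
    by (rule Eff_antimono[OF argmin_subset])
next
  assume "B_monotone_on (interior D) F \<phi>"
  then show "Eff F (interior D) \<inter> argmin F \<phi> = Eff (argmin F \<phi>) (interior D)"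
    by (rule Eff_argmin_eq)
next
  fix y0 assume "B_monotone_on (interior D) F \<phi>" and unique: "argmin F \<phi> = {y0}"
  then have "Eff F (interior D) \<inter> {y0} = {y0}"
    using Eff_argmin_eq[of "interior D" F \<phi>] by (simp add: Eff_singleton)
  then show "y0 \<in> Eff F (interior D)"
    by blast
next
  assume "strictly_B_monotone_on (interior D) F \<phi>"
  then show "argmin F \<phi> \<subseteq> Eff F (interior D)"
    by (rule argmin_subset_Eff)
qed

end
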